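(* Let $m=\varepsilon p_1^{\alpha_1}\cdots p_r^{\alpha_r}$ be a nonzero integer, with $\varepsilon=\pm1$, $p_1,\dots,p_r$ distinct positive primes and all $\alpha_i\ge 1$, and let $x\in\mathbb{Z}$. Let $c_1,\dots,c_{\varphi(m)}$ be a reduced residue system modulo $m$ and put $L(x,m)=(x+c_1)\cdots(x+c_{\varphi(m)})$. Let $d=\prod_{i:\,p_i\mid x}p_i^{\alpha_i}$ be the product of the full prime powers $p_i^{\alpha_i}$ over all primes $p_i$ dividing both $x$ and $m$ (empty product $=1$), and let $m'=m/d$. Put $e=-1$ if $m\in A$ and $e=+1$ if $m\notin A$. Then $$L(x,m)\equiv e \pmod d,\qquad L(x,m)\equiv 0\pmod{m'},$$ and, for any particular integer solution $(k_1^0,k_2^0)$ of the diophantine equation $k_2m'-k_1d=e$, $$L(x,m)\equiv e+k_1^0d\equiv k_2^0m'\pmod m.$$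
   Context: $A$ is the set of integers $m$ such that $m=\pm p^{\beta}$ or $m=\pm2p^{\beta}$ with $p$ an odd prime and $\beta\ge1$ an integer, or $m=\pm2^{\alpha}$ with $\alpha\in\{0,1,2\}$, or $m=0$. For a nonzero integer $m$, $\varphi(m)=\varphi(|m|)$ is Euler's function, and a reduced residue system modulo $m$ is a family of $\varphi(m)$ integers containing exactly one representative of each residue class modulo $m$ that is relatively prime to $m$. *)

theory Defs
  imports "HOL-Number_Theory.Number_Theory"
begin

definition A :: "int set" where
  "A = {m. (\<exists>(p::int) (\<beta>::nat). prime p \<and> odd p \<and> \<beta> \<ge> 1 \<and>
               (m = p ^ \<beta> \<or> m = - (p ^ \<beta>) \<or> m = 2 * p ^ \<beta> \<or> m = - (2 * p ^ \<beta>)))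
         \<or> (\<exists>\<alpha>\<in>{0, 1, 2::nat}. m = 2 ^ \<alpha> \<or> m = - (2 ^ \<alpha>))
         \<or> m = 0}"

definition phi :: "int \<Rightarrow> nat" where
  "phi m = totient (nat \<bar>m\<bar>)"

text \<open>
  The system is the family \<open>c 1, \<dots>, c (phi m)\<close>; values of \<open>c\<close> at other indices are
  irrelevant. Since there are exactly \<open>phi m\<close> residue classes coprime to \<open>m\<close>, the
  condition forces every member of the family to be coprime to \<open>m\<close>.
\<close>
definition reduced_residue_system :: "int \<Rightarrow> (nat \<Rightarrow> int) \<Rightarrow> bool" where
  "reduced_residue_system m c \<longleftrightarrow>
     (\<forall>a. coprime a m \<longrightarrow> (\<exists>!i. i \<in> {1..phi m} \<and> [c i = a] (mod m)))"

definition L :: "(nat \<Rightarrow> int) \<Rightarrow> int \<Rightarrow> int \<Rightarrow> int" where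
  "L c x m = (\<Prod>i = 1..phi m. x + c i)"

end

theory Submission
  imports Defs
begin

text \<open>
  Modulo \<open>d\<close>, the number \<open>x\<close> is divisible by every prime of the modulus, so adding \<open>x\<close>
  permutes the units (\<open>prod_shifted_totatives\<close>), and \<open>L c x m\<close> is congruent to the product of
  all units modulo \<open>m\<close>. By Gauss's generalization of Wilson's theorem (\<open>Gauss_Wilson\<close>) that product
  is \<open>-1\<close> if there is a primitive root modulo \<open>m\<close> and \<open>1\<close> otherwise; the nonzero moduli
  with primitive roots are those in \<open>A\<close>. This gives \<open>e\<close> modulo \<open>d\<close>
  (\<open>L_cong_on_shared_part\<close>). Modulo \<open>m'\<close>, on the other hand, \<open>x\<close> is a unit, so some \<open>c i\<close> is
  congruent to \<open>-x\<close> and a single factor of \<open>L c x m\<close> vanishes (\<open>complementary_part_dvd_L\<close>).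
  As \<open>d\<close> and \<open>m'\<close> are coprime, the two congruences determine \<open>L c x m\<close> modulo \<open>m\<close>, and
  \<open>e + k1 * d = k2 * m'\<close> satisfies both.

  For Gauss's theorem, a generator of the unit group settles the moduli with primitive roots. The
  other moduli are the powers \<open>2 ^ k\<close> with \<open>k \<ge> 3\<close>, reached from \<open>4\<close> by lifting units
  one exponent at a time (\<open>prod_totatives_two_power_Suc\<close>), and the products of two coprime factors
  above \<open>2\<close>. For the latter, the Chinese remainder theorem turns the product into an even power
  modulo either factor (\<open>prod_totatives_mult_coprime\<close>).
\<close>

section \<open>Products over the units modulo n\<close>

lemma totative_representative:
  fixes a :: int
  assumes "n > 0" "coprime a (int n)"
  shows "\<exists>t\<in>totatives n. [int t = a] (mod int n)"
proof (cases "n = 1")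
  \<comment> \<open>Since \<open>totatives 1 = {1}\<close>, the least nonnegative residue is the right choice only for \<open>n > 1\<close>.\<close>
  case True
  then show ?thesis by simp
next
  case False
  with assms have n: "n > 1" by simp
  define t where "t = nat (a mod int n)"
  have t: "int t = a mod int n" using n by (simp add: t_def)
  have cong: "[int t = a] (mod int n)" by (simp add: t)
  have "coprime (int t) (int n)"
    using assms(2) cong cong_imp_coprime cong_sym by blast
  hence cop: "coprime t n" by simp
  have "t < n" using t n by (metis of_nat_0_less_iff of_nat_less_iff pos_mod_bound assms(1))
  moreover have "t \<noteq> 0" using cop n by (intro notI) auto
  ultimately have "t \<in> totatives n" using cop by (simp add: in_totatives_iff)
  with cong show ?thesis by blast
qed

lemma totatives_cong_imp_eq:
  assumes "s \<in> totatives n" "t \<in> totatives n" "[int s = int t] (mod int n)"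
  shows "s = t"
proof (cases "n > 1")
  case True
  have "[s = t] (mod n)" using assms(3) by (simp add: cong_int_iff)
  with assms(1,2) True show ?thesis
    by (meson cong_less_modulus_unique_nat totatives_less)
next
  case False
  hence "n = 0 \<or> n = 1" by auto
  with assms(1,2) show ?thesis by auto
qed

text \<open>
  Surjectivity onto the unit classes is enough: an index set with as many elements as there
  are units is then matched one-to-one with them.
\<close>
lemma prod_over_unit_representatives:
  fixes f :: "int \<Rightarrow> int" and h :: "'a \<Rightarrow> int"
  assumes fin: "finite I" and card: "card I = totient n"
    and surj: "\<And>t. t \<in> totatives n \<Longrightarrow> \<exists>i\<in>I. [h i = int t] (mod int n)"
    and f: "\<And>u v. [u = v] (mod int n) \<Longrightarrow> [f u = f v] (mod int n)"
  shows "[(\<Prod>i\<in>I. f (h i)) = (\<Prod>t\<in>totatives n. f (int t))] (mod int n)"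
proof -
  from surj obtain g where g: "\<And>t. t \<in> totatives n \<Longrightarrow> g t \<in> I"
    "\<And>t. t \<in> totatives n \<Longrightarrow> [h (g t) = int t] (mod int n)"
    by metis
  have inj: "inj_on g (totatives n)"
  proof (rule inj_onI)
    fix s t assume st: "s \<in> totatives n" "t \<in> totatives n" "g s = g t"
    have "[int s = int t] (mod int n)"
      using g(2)[OF st(1)] g(2)[OF st(2)] st(3) by (metis cong_sym cong_trans)
    thus "s = t" using totatives_cong_imp_eq st by blast
  qed
  have "g ` totatives n = I"
    using fin g(1) card card_image[OF inj]
    by (intro card_subset_eq) (auto simp: totient_def)
  with inj have "bij_betw g (totatives n) I" by (simp add: bij_betw_def)
  hence "(\<Prod>i\<in>I. f (h i)) = (\<Prod>t\<in>totatives n. f (h (g t)))"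
    by (rule prod.reindex_bij_betw[symmetric])
  moreover have "[\<dots> = (\<Prod>t\<in>totatives n. f (int t))] (mod int n)"
    by (intro cong_prod f g(2))
  ultimately show ?thesis by simp
qed

text \<open>
  Adding \<open>x\<close> permutes the units modulo \<open>n\<close>, because coprimality to \<open>n\<close> only depends on the
  residues modulo the primes dividing \<open>n\<close>, and all of these divide \<open>x\<close>.
\<close>
lemma prod_shifted_totatives:
  fixes x :: int
  assumes "n > 0" and x: "\<And>p. prime p \<Longrightarrow> p dvd int n \<Longrightarrow> p dvd x"
  shows "[(\<Prod>t\<in>totatives n. x + int t) = (\<Prod>t\<in>totatives n. int t)] (mod int n)"
proof -
  show ?thesis
  proof (rule prod_over_unit_representatives[where f = "\<lambda>u. u"])
    fix t assume t: "t \<in> totatives n"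
    have "coprime (int t - x) (int n)"
    proof (rule ccontr)
      assume "\<not> coprime (int t - x) (int n)"
      hence "\<not> is_unit (gcd (int t - x) (int n))" by (simp add: coprime_iff_gcd_eq_1)
      then obtain p where "prime p" "p dvd gcd (int t - x) (int n)"
        using prime_divisor_exists[of "gcd (int t - x) (int n)"] assms(1) by auto
      hence p: "prime p" "p dvd int t - x" "p dvd int n" by auto
      hence "p dvd int t" using x[of p] dvd_add[of p "int t - x" x] by simp
      moreover have "coprime (int t) (int n)" using t by (simp add: in_totatives_iff)
      ultimately have "is_unit p" using p(3) by (meson coprime_common_divisor)
      with p(1) show False by auto
    qed
    then obtain s where s: "s \<in> totatives n" "[int s = int t - x] (mod int n)"
      using totative_representative assms(1) by blast
    hence "[x + int s = x + (int t - x)] (mod int n)" by (intro cong_add cong_refl)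
    with s(1) show "\<exists>s\<in>totatives n. [x + int s = int t] (mod int n)" by auto
  next
    show "card (totatives n) = totient n" by (simp add: totient_def)
  qed simp_all
qed

text \<open>
  By the Chinese remainder theorem every unit modulo \<open>a\<close> lifts to \<open>totient b\<close> units
  modulo \<open>a * b\<close>.
\<close>
lemma prod_totatives_mult_coprime:
  fixes f :: "int \<Rightarrow> int"
  assumes pos: "a > 0" "b > 0" and cop: "coprime a b"
    and f: "\<And>u v. [u = v] (mod int a) \<Longrightarrow> [f u = f v] (mod int a)"
  shows "[(\<Prod>t\<in>totatives (a * b). f (int t)) = (\<Prod>t\<in>totatives a. f (int t)) ^ totient b] (mod int a)"
proof -
  consider "a = 1" | "b = 1" | "a > 1" "b > 1" using pos by linarith
  thus ?thesis
  proof cases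
    case 3
    have "[(\<Prod>t\<in>totatives (a * b). f (int t)) = (\<Prod>t\<in>totatives (a * b). f (int (t mod a)))] (mod int a)"
      by (intro cong_prod f) (simp add: zmod_int)
    also have "(\<Prod>t\<in>totatives (a * b). f (int (t mod a))) =
        (\<Prod>(s, u)\<in>totatives a \<times> totatives b. f (int s))"
      using prod.reindex_bij_betw[OF bij_betw_totatives[OF 3 cop], of "\<lambda>(s, u). f (int s)"] by simp
    also have "\<dots> = (\<Prod>s\<in>totatives a. f (int s)) ^ totient b"
      by (simp add: prod.cartesian_product[symmetric] totient_def prod_power_distrib)
    finally show ?thesis .
  qed auto
qed

section \<open>The product of all units: Gauss's generalization of Wilson's theorem\<close>

text \<open>
  For \<open>n > 2\<close> and a generator \<open>g\<close> of the unit group, whose order is some \<open>2 * k\<close>, the class of \<open>-1\<close> is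
  \<open>g ^ k\<close>, and the product of all units is \<open>g\<close> to the power \<open>0 + \<dots> + (2 * k - 1) = k * (2 * k - 1)\<close>.
\<close>
lemma prod_totatives_cyclic:
  assumes "residue_primroot n g"
  shows "[(\<Prod>t\<in>totatives n. int t) = -1] (mod int n)"
proof -
  from assms have n0: "n > 0" and ordg: "ord n g = totient n"
    by (auto simp: residue_primroot_def)
  consider "n = 1" | "n = 2" | "n > 2" using n0 by linarith
  thus ?thesis
  proof cases
    case 2
    have "totatives 2 = {1::nat}"
      by (auto simp: in_totatives_iff le_Suc_eq numeral_2_eq_2)
    with 2 show ?thesis by (simp add: cong_iff_dvd_diff)
  next
    case 3
    hence bij: "bij_betw (\<lambda>i. g ^ i mod n) {..<totient n} (totatives n)"
      by (intro residue_primroot_is_generator assms) auto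
    have "n - 1 \<in> totatives n" using 3 by (intro minus_one_in_totatives) auto
    then obtain k where k: "k < totient n" "g ^ k mod n = n - 1"
      using bij by (metis (no_types, lifting) bij_betw_imp_surj_on imageE lessThan_iff)
    have "int (g ^ k) mod int n = int n - 1"
      using k(2) 3 by (metis (no_types, opaque_lifting) less_imp_le_nat n0 of_nat_1 of_nat_diff Suc_leI One_nat_def zmod_int)
    hence "int (g ^ k) mod int n = (-1) mod int n" using 3 by (simp add: zmod_minus1)
    hence gk: "[int g ^ k = -1] (mod int n)" by (simp add: cong_def)
    have "[(int g ^ k) ^ 2 = (-1) ^ 2] (mod int n)" by (intro cong_pow gk)
    hence "[int (g ^ (2 * k)) = int 1] (mod int n)" by (simp add: power_mult mult.commute)
    hence "[g ^ (2 * k) = 1] (mod n)" by (simp only: cong_int_iff)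
    hence dvd: "totient n dvd 2 * k" by (simp add: ord_divides[symmetric] ordg[symmetric])
    have "k \<noteq> 0" using k(2) 3 by (intro notI) auto
    hence tot: "totient n = 2 * k" using dvd k(1)
    proof -
      obtain q where q: "2 * k = totient n * q" using dvd by (elim dvdE)
      have "totient n * q < totient n * 2" using q k(1) by linarith
      hence "q < 2" by simp
      moreover have "q \<noteq> 0" using q \<open>k \<noteq> 0\<close> by (intro notI) auto
      ultimately have "q = 1" by simp
      with q show ?thesis by simp
    qed
    have gauss: "(\<Sum>i<2 * k. i) = k * (2 * k - 1)"
      by (induction k) (auto simp: algebra_simps)
    have "(\<Prod>t\<in>totatives n. int t) = (\<Prod>i<totient n. int (g ^ i mod n))"
      by (rule prod.reindex_bij_betw[OF bij, symmetric])
    also have "[\<dots> = (\<Prod>i<totient n. int g ^ i)] (mod int n)"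
      by (intro cong_prod) (simp add: zmod_int)
    also have "(\<Prod>i<totient n. int g ^ i) = (int g ^ k) ^ (2 * k - 1)"
      by (simp add: tot power_sum[symmetric] gauss power_mult[symmetric])
    also have "[\<dots> = (-1) ^ (2 * k - 1)] (mod int n)" by (intro cong_pow gk)
    also have "(-1) ^ (2 * k - 1) = (-1 :: int)" using \<open>k \<noteq> 0\<close> by simp
    finally show ?thesis .
  qed auto
qed

lemma totatives_two_power_Suc:
  assumes "k > 0"
  shows "totatives (2 ^ Suc k) = totatives (2 ^ k) \<union> (\<lambda>a. a + 2 ^ k) ` totatives (2 ^ k)"
    (is "?L = ?R")
proof -
  have odd: "coprime a (2 ^ j) \<longleftrightarrow> odd a" if "j > 0" for a j :: nat
    using that by (simp add: coprime_commute[of a])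
  show ?thesis
  proof (intro equalityI subsetI)
    fix a assume a: "a \<in> ?L"
    hence ao: "odd a" "a \<le> 2 * 2 ^ k" by (auto simp: in_totatives_iff)
    show "a \<in> ?R"
    proof (cases "a \<le> 2 ^ k")
      case True
      with ao assms show ?thesis by (auto simp: in_totatives_iff odd odd_pos)
    next
      case False
      with ao assms have "a - 2 ^ k \<in> totatives (2 ^ k)" by (auto simp: in_totatives_iff odd)
      moreover have "a = (a - 2 ^ k) + 2 ^ k" using False by simp
      ultimately show ?thesis by blast
    qed
  next
    fix a assume "a \<in> ?R"
    thus "a \<in> ?L" using assms by (auto simp: in_totatives_iff odd)
  qed
qed

lemma cong_two_power_SucI:
  fixes u v z :: int
  assumes "u - v = 2 ^ k * z" "even z"
  shows "[u = v] (mod 2 ^ Suc k)"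
  unfolding cong_iff_dvd_diff assms(1) power_Suc2 using assms(2) by (intro mult_dvd_mono) auto

text \<open>
  For odd \<open>a\<close> the second lift \<open>a + 2 ^ k\<close> is congruent to \<open>a * (1 + 2 ^ k)\<close> modulo
  \<open>2 ^ Suc k\<close>. The number of lifted units is even and \<open>(1 + 2 ^ k)\<^sup>2\<close> is congruent to \<open>1\<close>, so
  the new product is the square of the old one; squaring a number that is \<open>\<plusminus>1\<close> modulo
  \<open>2 ^ k\<close> gives \<open>1\<close> modulo \<open>2 ^ Suc k\<close>.
\<close>
lemma prod_totatives_two_power_Suc:
  assumes k: "k \<ge> 2"
    and W: "[(\<Prod>t\<in>totatives (2 ^ k). int t) = w] (mod 2 ^ k)" and w: "w = 1 \<or> w = -1"
  shows "[(\<Prod>t\<in>totatives (2 ^ Suc k). int t) = 1] (mod 2 ^ Suc k)"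
proof -
  let ?T = "totatives (2 ^ k)"
  let ?W = "\<Prod>t\<in>?T. int t"
  let ?M = "2 ^ Suc k :: int"
  have ek: "even ((2::int) ^ k)" using k by simp
  have "(2::nat) ^ 1 < 2 ^ k" using k by (intro power_strict_increasing) auto
  hence "even (card ?T)" using totient_even[of "2 ^ k"] by (simp add: totient_def)
  then obtain j where j: "card ?T = 2 * j" by (elim evenE)
  have "[int t + 2 ^ k = int t * (1 + 2 ^ k)] (mod ?M)" if "t \<in> ?T" for t
  proof (rule cong_two_power_SucI)
    show "int t + 2 ^ k - int t * (1 + 2 ^ k) = 2 ^ k * (1 - int t)" by (simp add: algebra_simps)
    show "even (1 - int t)" using that k by (auto simp: in_totatives_iff)
  qed
  hence "[(\<Prod>t\<in>?T. int t + 2 ^ k) = (\<Prod>t\<in>?T. int t * (1 + 2 ^ k))] (mod ?M)"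
    by (rule cong_prod)
  also have "(\<Prod>t\<in>?T. int t * (1 + 2 ^ k)) = ?W * ((1 + 2 ^ k)\<^sup>2) ^ j"
    by (simp add: prod.distrib j power_mult)
  also have "[\<dots> = ?W * 1 ^ j] (mod ?M)"
  proof (intro cong_mult cong_refl cong_pow, rule cong_two_power_SucI)
    show "(1 + 2 ^ k)\<^sup>2 - 1 = 2 ^ k * (2 + 2 ^ k :: int)" by (simp add: algebra_simps power2_eq_square)
    show "even (2 + 2 ^ k :: int)" using ek by simp
  qed
  finally have lift: "[(\<Prod>t\<in>?T. int t + 2 ^ k) = ?W] (mod ?M)" by simp
  have disj: "?T \<inter> (\<lambda>a. a + 2 ^ k) ` ?T = {}"
    by (auto simp: in_totatives_iff)
  have "(\<Prod>t\<in>totatives (2 ^ Suc k). int t) = (\<Prod>t\<in>?T \<union> (\<lambda>a. a + 2 ^ k) ` ?T. int t)"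
    using k by (subst totatives_two_power_Suc) auto
  also have "\<dots> = ?W * (\<Prod>t\<in>?T. int t + 2 ^ k)"
    by (subst prod.union_disjoint[OF _ _ disj]) (auto simp: prod.reindex inj_on_def)
  also have "[\<dots> = ?W * ?W] (mod ?M)" by (intro cong_mult cong_refl lift)
  also have "[?W * ?W = 1] (mod ?M)"
  proof -
    obtain q where q: "?W = w + 2 ^ k * q"
      using W by (metis cong_iff_lin cong_sym mult.commute)
    show ?thesis
    proof (rule cong_two_power_SucI)
      show "?W * ?W - 1 = 2 ^ k * (2 * w * q + 2 ^ k * q\<^sup>2)"
        unfolding q using w by (auto simp: power2_eq_square algebra_simps)
      show "even (2 * w * q + 2 ^ k * q\<^sup>2)" using ek by simp
    qed
  qed
  finally show ?thesis .
qed

lemma prod_totatives_two_power: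
  assumes "k \<ge> 3"
  shows "[(\<Prod>t\<in>totatives (2 ^ k). int t) = 1] (mod 2 ^ k)"
  using assms
proof (induction k rule: dec_induct)
  case base
  obtain g where "residue_primroot 4 g"
    using residue_primroot_iff_in_cyclic_moduli[of 4] by (auto simp: cyclic_moduli_def)
  from prod_totatives_cyclic[OF this]
  have "[(\<Prod>t\<in>totatives (2 ^ 2). int t) = -1] (mod 2 ^ 2)" by simp
  from prod_totatives_two_power_Suc[OF _ this] show ?case by (simp add: eval_nat_numeral)
next
  case (step k)
  thus ?case by (intro prod_totatives_two_power_Suc[where w = 1]) auto
qed

lemma noncyclic_modulus_cases:
  assumes "n > 0" "n \<notin> cyclic_moduli"
  obtains k where "k \<ge> 3" "n = 2 ^ k"
        | u v where "u > 2" "v > 2" "coprime u v" "n = u * v"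
proof (cases "\<exists>k. n = 2 ^ k")
  case True
  then obtain k where n: "n = 2 ^ k" by auto
  with assms have "k \<noteq> 0 \<and> k \<noteq> 1 \<and> k \<noteq> 2" by (auto simp: cyclic_moduli_def)
  with n that(1)[of k] show ?thesis by simp
next
  case False
  have "n \<noteq> 0" "n \<noteq> 1" using assms by (auto simp: cyclic_moduli_def)
  with False have "\<exists>p\<in>prime_factors n. p \<noteq> 2"
    using Ex_other_prime_factor[of n 2] by auto
  from divide_out_primepow_ex[OF \<open>n \<noteq> 0\<close> this]
  obtain p k v where p: "p \<noteq> 2" "prime p" "p dvd n" "\<not> p dvd v" "0 < k" "n = p ^ k * v"
    by metis
  have "odd p" using p primes_dvd_imp_eq[of 2 p] by auto
  have cop: "coprime (p ^ k) v" using p prime_imp_coprime by auto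
  have "v \<noteq> 0" using p by (intro notI) auto
  moreover have "v \<noteq> 1"
  proof
    assume "v = 1"
    hence "n = p ^ k" using p by simp
    with p \<open>odd p\<close> assms(2) show False unfolding cyclic_moduli_def by blast
  qed
  moreover have "v \<noteq> 2"
  proof
    assume "v = 2"
    hence "n = 2 * p ^ k" using p by simp
    with p \<open>odd p\<close> assms(2) show False unfolding cyclic_moduli_def by blast
  qed
  ultimately have "v > 2" by linarith
  moreover have "p ^ k > 2"
  proof -
    have "p > 2" using p prime_ge_2_nat[of p] by simp
    also have "p ^ 1 \<le> p ^ k" using p prime_ge_1_nat by (intro power_increasing) auto
    finally show ?thesis by simp
  qed
  ultimately show ?thesis using that(2) cop p(6) by blast
qed

text \<open>
  A split \<open>n = u * v\<close> into coprime factors above \<open>2\<close> excludes \<open>-1\<close>: modulo \<open>u\<close> the product is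
  a power of the product of the units modulo \<open>u\<close>, which is \<open>\<plusminus>1\<close> by induction, and the exponent
  \<open>totient v\<close> is even.
\<close>
theorem Gauss_Wilson:
  assumes "n > 0"
  shows "[(\<Prod>t\<in>totatives n. int t) = (if n \<in> cyclic_moduli then -1 else 1)] (mod int n)"
  using assms
proof (induction n rule: less_induct)
  case (less n)
  show ?case
  proof (cases "n \<in> cyclic_moduli")
    case True
    then obtain g where "residue_primroot n g"
      using residue_primroot_iff_in_cyclic_moduli by blast
    with True show ?thesis by (simp add: prod_totatives_cyclic)
  next
    case False
    from \<open>n > 0\<close> False show ?thesis
    proof (cases rule: noncyclic_modulus_cases)
      case (1 k)
      with False prod_totatives_two_power[of k] show ?thesis by simp
    next
      case (2 u v)
      have factor: "[(\<Prod>t\<in>totatives (a * b). int t) = 1] (mod int a)"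
        if ab: "a > 2" "b > 2" "coprime a b" "n = a * b" for a b
      proof -
        let ?s = "if a \<in> cyclic_moduli then -1 else 1 :: int"
        have "[(\<Prod>t\<in>totatives (a * b). int t) = (\<Prod>t\<in>totatives a. int t) ^ totient b] (mod int a)"
          using ab prod_totatives_mult_coprime[of a b "\<lambda>u. u"] by simp
        also have "[(\<Prod>t\<in>totatives a. int t) ^ totient b = ?s ^ totient b] (mod int a)"
          using less.IH[of a] ab by (intro cong_pow) simp
        also have "?s ^ totient b = 1" using totient_even[of b] ab by auto
        finally show ?thesis .
      qed
      have "[(\<Prod>t\<in>totatives n. int t) = 1] (mod int u * int v)"
        using factor[of u v] factor[of v u] 2
        by (intro coprime_cong_mult) (auto simp: mult.commute coprime_commute)
      with 2 False show ?thesis by simp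
    qed
  qed
qed

section \<open>The product over a shifted reduced residue system\<close>

lemma mem_A_iff_cyclic_modulus:
  assumes "m \<noteq> 0"
  shows "m \<in> A \<longleftrightarrow> nat \<bar>m\<bar> \<in> cyclic_moduli"
proof
  assume "m \<in> A"
  with assms consider p \<beta> where "prime (p::int)" "odd p" "\<beta> \<ge> (1::nat)" "\<bar>m\<bar> = p ^ \<beta> \<or> \<bar>m\<bar> = 2 * p ^ \<beta>"
    | "\<bar>m\<bar> \<in> {1, 2, 4}"
  proof -
    from \<open>m \<in> A\<close> assms consider p \<beta> where "prime (p::int)" "odd p" "\<beta> \<ge> (1::nat)"
        "m = p ^ \<beta> \<or> m = - (p ^ \<beta>) \<or> m = 2 * p ^ \<beta> \<or> m = - (2 * p ^ \<beta>)"
      | \<alpha> where "\<alpha> \<in> {0, 1, 2::nat}" "m = 2 ^ \<alpha> \<or> m = - (2 ^ \<alpha>)"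
      unfolding A_def by blast
    thus thesis
    proof cases
      case 1
      have "p ^ \<beta> > 0" using prime_gt_0_int[OF 1(1)] by simp
      with 1 show thesis by (intro that(1)[of p \<beta>]) auto
    next
      case 2
      thus thesis by (intro that(2)) auto
    qed
  qed
  thus "nat \<bar>m\<bar> \<in> cyclic_moduli"
  proof cases
    case 1
    then obtain q where q: "p = int q" using prime_ge_0_int nonneg_int_cases by blast
    from 1(4) have "int (nat \<bar>m\<bar>) = int (q ^ \<beta>) \<or> int (nat \<bar>m\<bar>) = int (2 * q ^ \<beta>)"
      by (simp add: q)
    hence "nat \<bar>m\<bar> = q ^ \<beta> \<or> nat \<bar>m\<bar> = 2 * q ^ \<beta>" by (simp only: of_nat_eq_iff)
    moreover have "prime q" "odd q" "\<beta> > 0" using 1 q by auto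
    ultimately show ?thesis unfolding cyclic_moduli_def by blast
  qed (auto simp: cyclic_moduli_def)
next
  assume "nat \<bar>m\<bar> \<in> cyclic_moduli"
  then consider p k where "prime (p::nat)" "odd p" "k > 0" "nat \<bar>m\<bar> = p ^ k \<or> nat \<bar>m\<bar> = 2 * p ^ k"
    | "nat \<bar>m\<bar> \<in> {1, 2, 4}"
    unfolding cyclic_moduli_def by blast
  thus "m \<in> A"
  proof cases
    case 1
    hence "int (nat \<bar>m\<bar>) = int p ^ k \<or> int (nat \<bar>m\<bar>) = 2 * int p ^ k"
      by (metis of_nat_mult of_nat_numeral of_nat_power)
    hence "m = int p ^ k \<or> m = - (int p ^ k) \<or> m = 2 * int p ^ k \<or> m = - (2 * int p ^ k)"
      by linarith
    moreover have "prime (int p)" "odd (int p)" "k \<ge> 1" using 1 by auto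
    ultimately show ?thesis unfolding A_def by blast
  next
    case 2
    hence "m \<in> {1, -1, 2, -2, 4, -4}" by auto
    thus ?thesis unfolding A_def by auto
  qed
qed

lemma prod_reduced_residue_system:
  fixes f :: "int \<Rightarrow> int"
  assumes "reduced_residue_system m c"
    and "\<And>u v. [u = v] (mod m) \<Longrightarrow> [f u = f v] (mod m)"
  shows "[(\<Prod>i = 1..phi m. f (c i)) = (\<Prod>t\<in>totatives (nat \<bar>m\<bar>). f (int t))] (mod m)"
proof -
  have "[(\<Prod>i = 1..phi m. f (c i)) = (\<Prod>t\<in>totatives (nat \<bar>m\<bar>). f (int t))] (mod int (nat \<bar>m\<bar>))"
  proof (rule prod_over_unit_representatives[where f = f])
    fix t assume "t \<in> totatives (nat \<bar>m\<bar>)"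
    hence "coprime (int t) (int (nat \<bar>m\<bar>))"
      by (simp only: coprime_int_iff in_totatives_iff)
    hence "coprime (int t) m" by simp
    with assms(1) have "\<exists>i\<in>{1..phi m}. [c i = int t] (mod m)"
      unfolding reduced_residue_system_def by blast
    thus "\<exists>i\<in>{1..phi m}. [c i = int t] (mod int (nat \<bar>m\<bar>))" by simp
  next
    show "[f u = f v] (mod int (nat \<bar>m\<bar>))" if "[u = v] (mod int (nat \<bar>m\<bar>))" for u v
      using assms(2)[of u v] that by simp
  next
    show "card {1..phi m} = totient (nat \<bar>m\<bar>)" by (simp add: phi_def)
  qed (rule finite_atLeastAtMost)
  thus ?thesis by (rule cong_dvd_modulus) simp
qed

text \<open>
  Removing the shift by \<open>x\<close> is only possible modulo \<open>d\<close>, whose primes divide \<open>x\<close>. The full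
  product is therefore rewritten as a power of the product over the units modulo \<open>d\<close>, the shift is
  dropped there, and the same rewriting is undone. The product is then that of all units modulo
  \<open>m\<close>, so the sign is the one belonging to \<open>m\<close>, and no comparison with the sign belonging to
  \<open>d\<close> arises.
\<close>
theorem L_cong_on_shared_part:
  fixes m x d m' :: int
  assumes "m \<noteq> 0" "m = d * m'" "d > 0" "coprime d m'" "reduced_residue_system m c"
    and "\<And>p. prime p \<Longrightarrow> p dvd d \<Longrightarrow> p dvd x"
  shows "[L c x m = (if m \<in> A then -1 else 1)] (mod d)"
proof -
  define a b where "a = nat d" and "b = nat \<bar>m'\<bar>"
  have d: "int a = d" using assms(3) by (simp add: a_def)
  have n: "nat \<bar>m\<bar> = a * b" using assms(2,3) by (simp add: a_def b_def abs_mult nat_mult_distrib)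
  have pos: "a > 0" "b > 0" using assms(1-3) by (auto simp: a_def b_def)
  have "coprime (int a) (int b)" using assms(3,4) by (simp add: a_def b_def)
  hence cop: "coprime a b" by simp
  have split: "[(\<Prod>t\<in>totatives (a * b). f (int t)) = (\<Prod>t\<in>totatives a. f (int t)) ^ totient b] (mod d)"
    if "\<And>u v. [u = v] (mod d) \<Longrightarrow> [f u = f v] (mod d)" for f :: "int \<Rightarrow> int"
    using prod_totatives_mult_coprime[OF pos cop, of f] that by (simp add: d)
  have "[L c x m = (\<Prod>t\<in>totatives (a * b). x + int t)] (mod m)"
    unfolding L_def n[symmetric]
    by (rule prod_reduced_residue_system[OF assms(5)]) (intro cong_add cong_refl)
  hence "[L c x m = (\<Prod>t\<in>totatives (a * b). x + int t)] (mod d)"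
    by (rule cong_dvd_modulus) (simp add: assms(2))
  also have "[(\<Prod>t\<in>totatives (a * b). x + int t) = (\<Prod>t\<in>totatives a. x + int t) ^ totient b] (mod d)"
    by (rule split) (intro cong_add cong_refl)
  also have "[(\<Prod>t\<in>totatives a. x + int t) ^ totient b = (\<Prod>t\<in>totatives a. int t) ^ totient b] (mod d)"
    using prod_shifted_totatives[of a x, unfolded d, OF pos(1) assms(6)] by (rule cong_pow)
  also have "[(\<Prod>t\<in>totatives a. int t) ^ totient b = (\<Prod>t\<in>totatives (a * b). int t)] (mod d)"
    using split[of "\<lambda>u. u"] by (simp add: cong_sym)
  also have "[(\<Prod>t\<in>totatives (a * b). int t) = (if m \<in> A then -1 else 1)] (mod d)"
  proof -
    have "[(\<Prod>t\<in>totatives (a * b). int t) = (if m \<in> A then -1 else 1)] (mod int (a * b))"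
      using Gauss_Wilson[of "a * b"] pos mem_A_iff_cyclic_modulus[OF assms(1)] n by simp
    thus ?thesis by (rule cong_dvd_modulus) (simp add: d)
  qed
  finally show ?thesis .
qed

text \<open>
  A single factor accounts for all of \<open>m'\<close>: as \<open>x\<close> is a unit modulo \<open>m'\<close>, the class that is
  \<open>-x\<close> modulo \<open>m'\<close> and \<open>1\<close> modulo \<open>d\<close> is represented in the system.
\<close>
lemma complementary_part_dvd_L:
  fixes m x d m' :: int
  assumes "m = d * m'" "coprime d m'" "reduced_residue_system m c" "coprime x m'"
  shows "m' dvd L c x m"
proof -
  obtain a where a: "[a = 1] (mod d)" "[a = - x] (mod m')"
    using binary_chinese_remainder_int[OF assms(2)] by blast
  have "coprime a d" using a(1) cong_imp_coprime cong_sym coprime_1_left by blast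
  moreover have "coprime a m'"
    using a(2) assms(4) cong_imp_coprime cong_sym coprime_minus_left_iff by blast
  ultimately have "coprime a m" using assms(1) by simp
  then obtain i where i: "i \<in> {1..phi m}" "[c i = a] (mod m)"
    using assms(3) unfolding reduced_residue_system_def by blast
  have "[c i = a] (mod m')" using i(2) assms(1) cong_dvd_modulus dvd_triv_right by blast
  hence "[c i = - x] (mod m')" using a(2) cong_trans by blast
  hence "m' dvd x + c i" by (simp add: cong_iff_dvd_diff add.commute)
  also have "x + c i dvd L c x m" unfolding L_def using i(1) by (intro dvd_prodI) auto
  finally show ?thesis .
qed

theorem mainTheorem1:
  fixes m x \<epsilon> d m' e :: int
    and r :: nat
    and p :: "nat \<Rightarrow> int"
    and \<alpha> :: "nat \<Rightarrow> nat"
    and c :: "nat \<Rightarrow> int"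
  assumes "\<epsilon> = 1 \<or> \<epsilon> = -1"
    and "\<And>i. i \<in> {1..r} \<Longrightarrow> prime (p i)"
    and "inj_on p {1..r}"
    and "\<And>i. i \<in> {1..r} \<Longrightarrow> \<alpha> i \<ge> 1"
    and "m = \<epsilon> * (\<Prod>i = 1..r. p i ^ \<alpha> i)"
    and "reduced_residue_system m c"
    and "d = (\<Prod>i \<in> {i \<in> {1..r}. p i dvd x}. p i ^ \<alpha> i)"
    and "m' = m div d"
    and "e = (if m \<in> A then -1 else 1)"
  shows "[L c x m = e] (mod d) \<and>
         [L c x m = 0] (mod m') \<and>
         (\<forall>k1 k2. k2 * m' - k1 * d = e \<longrightarrow>
            [L c x m = e + k1 * d] (mod m) \<and>
            [e + k1 * d = k2 * m'] (mod m))"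
proof -
  let ?S = "{i \<in> {1..r}. p i dvd x}"
  let ?U = "{i \<in> {1..r}. \<not> p i dvd x}"
  define u where "u = (\<Prod>i\<in>?U. p i ^ \<alpha> i)"
  have pr: "prime (p i)" if "i \<in> {1..r}" for i using assms(2) that .
  have cop_pow: "coprime (p i ^ \<alpha> i) (p j ^ \<alpha> j)" if "i \<in> {1..r}" "j \<in> {1..r}" "i \<noteq> j" for i j
  proof -
    have "p i \<noteq> p j" using assms(3) that by (auto dest: inj_onD)
    thus ?thesis using pr that by (intro coprime_power_left_iff[THEN iffD2] disjI1
      coprime_power_right_iff[THEN iffD2] primes_coprime)
  qed
  have "?S \<union> ?U = {1..r}" by auto
  hence prod_split: "(\<Prod>i = 1..r. p i ^ \<alpha> i) = d * u"
    using prod.union_disjoint[of ?S ?U "\<lambda>i. p i ^ \<alpha> i"] assms(7) u_def by auto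
  have pow_pos: "p i ^ \<alpha> i > 0" if "i \<in> {1..r}" for i
    using prime_gt_0_int[OF pr[OF that]] by simp
  have dpos: "d > 0" unfolding assms(7) by (intro prod_pos) (use pow_pos in simp)
  have upos: "u > 0" unfolding u_def by (intro prod_pos) (use pow_pos in simp)
  have m: "m = d * (\<epsilon> * u)" using assms(5) prod_split by simp
  have m': "m' = \<epsilon> * u" using assms(8) m dpos by simp
  have m0: "m \<noteq> 0" using m dpos upos assms(1) by auto
  have mdm: "m = d * m'" using m m' by simp
  have "coprime d u" unfolding assms(7) u_def
    by (intro prod_coprime_left prod_coprime_right cop_pow) auto
  hence cop: "coprime d m'" using assms(1) m' by auto
  have "coprime x (p i ^ \<alpha> i)" if "i \<in> ?U" for i
    using prime_imp_coprime[of "p i" x] pr[of i] that by (simp add: coprime_commute)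
  hence "coprime x u" unfolding u_def by (intro prod_coprime_right)
  hence copx: "coprime x m'" using assms(1) m' by auto
  have prime_d: "q dvd x" if q: "prime q" "q dvd d" for q
  proof -
    obtain i where i: "i \<in> ?S" "q dvd p i ^ \<alpha> i"
      using q unfolding assms(7) by (auto simp: prime_dvd_prod_iff)
    hence "q dvd p i" using q(1) prime_dvd_power by blast
    with i show ?thesis by (auto intro: dvd_trans)
  qed
  have Ld: "[L c x m = e] (mod d)"
    unfolding assms(9) by (rule L_cong_on_shared_part[OF m0 mdm dpos cop assms(6) prime_d])
  have Lm': "[L c x m = 0] (mod m')"
    using complementary_part_dvd_L[OF mdm cop assms(6) copx] by (simp add: cong_0_iff)
  have "[L c x m = e + k1 * d] (mod m) \<and> [e + k1 * d = k2 * m'] (mod m)"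
    if k: "k2 * m' - k1 * d = e" for k1 k2
  proof -
    have eq: "e + k1 * d = k2 * m'" using k by simp
    have "[e = e + k1 * d] (mod d)" by (simp add: cong_iff_dvd_diff)
    with Ld have "[L c x m = e + k1 * d] (mod d)" by (rule cong_trans)
    moreover have "[0 = e + k1 * d] (mod m')" unfolding eq by (simp add: cong_iff_dvd_diff)
    with Lm' have "[L c x m = e + k1 * d] (mod m')" by (rule cong_trans)
    ultimately have "[L c x m = e + k1 * d] (mod m)"
      unfolding mdm using cop by (intro coprime_cong_mult)
    with eq show ?thesis by simp
  qed
  with Ld Lm' show ?thesis by blast
qed

end
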